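(* Let $k\ge1$ be an integer, let $Y$ follow the Irwin–Hall distribution with parameter $k$, and let $X=Y-\frac k2$. Then for $0\le x\le\frac k2$, $$\mathbb{P}(X\le-x)=\mathbb{P}(X\ge x)\le\exp\left(-k\,h_{1/2}\left(\frac12+\frac xk\right)\right)\le\exp\left(-\frac{x^2}{k}\right).$$ There also exist universal constants $c,c',C>0$ (independent of $k$ and $x$) such that for all $0\le x\le c'k$, $$\mathbb{P}(X\le-x)=\mathbb{P}(X\ge x)\ge c\exp\left(-C\frac{x^2}{k}\right).$$
   Context: The Irwin–Hall distribution with parameter $k$ is the distribution of $\sum_{i=1}^kU_i$, where $U_1,\dots,U_k$ are i.i.d. uniform on $[0,1]$. For $0<u,v<1$, $h_u(v)=v\log\left(\frac vu\right)+(1-v)\log\left(\frac{1-v}{1-u}\right)$ is the Kullback–Leibler divergence between the Bernoulli distributions with parameters $u$ and $v$; at $v=1$ the convention $0\log0=0$ is used, so $h_{1/2}(1)=\log2$. *)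

theory Defs
  imports "HOL-Probability.Probability"
begin

definition irwin_hall :: "nat \<Rightarrow> real measure" where
  "irwin_hall k =
     distr (\<Pi>\<^sub>M i\<in>{..<k}. uniform_measure lborel {0..1}) borel (\<lambda>u. \<Sum>i<k. u i)"

definition follows_irwin_hall :: "'a measure \<Rightarrow> ('a \<Rightarrow> real) \<Rightarrow> nat \<Rightarrow> bool" where
  "follows_irwin_hall M Y k \<longleftrightarrow>
     prob_space M \<and> Y \<in> borel_measurable M \<and> distr M borel Y = irwin_hall k"

(* At v = 1 (and v = 0) the convention 0 log 0 = 0 holds automatically, since 0 * ln 0 = 0. *)
definition bernoulli_KL :: "real \<Rightarrow> real \<Rightarrow> real" where
  "bernoulli_KL u v = v * ln (v / u) + (1 - v) * ln ((1 - v) / (1 - u))"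

lemma bernoulli_KL_half_one: "bernoulli_KL (1/2) 1 = ln 2"
  by (simp add: bernoulli_KL_def)

lemma follows_irwin_hall_sum:
  fixes U :: "nat \<Rightarrow> 'a \<Rightarrow> real"
  assumes "prob_space M"
    and "prob_space.indep_vars M (\<lambda>_. borel) U {..<k}" and "k \<ge> 1"
    and U: "\<And>i. i < k \<Longrightarrow> distr M borel (U i) = uniform_measure lborel {0..1}"
  shows "follows_irwin_hall M (\<lambda>\<omega>. \<Sum>i<k. U i \<omega>) k"
proof -
  interpret prob_space M by fact
  have m: "U i \<in> borel_measurable M" if "i < k" for i
    using assms(2) that by (auto simp: indep_vars_def)
  have ne: "{..<k} \<noteq> {}" using assms(3) by (auto simp: lessThan_empty_iff)
  have "distr M (\<Pi>\<^sub>M i\<in>{..<k}. borel) (\<lambda>\<omega>. \<lambda>i\<in>{..<k}. U i \<omega>) =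
        (\<Pi>\<^sub>M i\<in>{..<k}. distr M borel (U i))"
    using assms(2) indep_vars_iff_distr_eq_PiM'[OF ne, of U "\<lambda>_. borel"] m by auto
  also have "\<dots> = (\<Pi>\<^sub>M i\<in>{..<k}. uniform_measure lborel {0..1})"
    by (intro PiM_cong) (auto simp: U)
  finally have e: "(\<Pi>\<^sub>M i\<in>{..<k}. uniform_measure lborel {0..1}) =
      distr M (\<Pi>\<^sub>M i\<in>{..<k}. borel) (\<lambda>\<omega>. \<lambda>i\<in>{..<k}. U i \<omega>)" by simp
  have "irwin_hall k = distr M borel ((\<lambda>u. \<Sum>i<k. u i) \<circ> (\<lambda>\<omega>. \<lambda>i\<in>{..<k}. U i \<omega>))"
    unfolding irwin_hall_def e by (intro distr_distr measurable_restrict) (auto simp: m)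
  also have "\<dots> = distr M borel (\<lambda>\<omega>. \<Sum>i<k. U i \<omega>)"
    by (intro distr_cong) auto
  finally show ?thesis
    using m by (auto simp: follows_irwin_hall_def prob_space_axioms)
qed

end

theory Submission
  imports Defs
begin

text \<open>
  Write \<open>S\<close> for the centred sum of \<open>k\<close> independent uniform variables.  The two tails agree because
  \<open>u \<mapsto> 1 - u\<close> preserves the uniform law and turns \<open>S\<close> into \<open>- S\<close>.

  For the upper bound, convexity of the exponential puts \<open>exp (l v)\<close> below its chord on
  \<open>[-1/2, 1/2]\<close>, so the moment generating function of a centred uniform variable is at most
  \<open>cosh (l/2)\<close>, that of a fair sign with values \<open>\<plusminus>1/2\<close> (\<open>mgf_centred_le\<close>).  Chernoff's method then gives
  \<open>exp (- l x) * cosh (l/2) ^ k\<close>, and minimising over \<open>l\<close> produces exactly the Bernoulli divergence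
  (\<open>prob_S_upper\<close>).  The comparison with \<open>exp (- x\<^sup>2 / k)\<close> is a weak form of Pinsker's inequality
  (\<open>bernoulli_KL_half_ge_square\<close>).

  For the lower bound, the second and fourth moments show that a sum of \<open>m\<close> variables exceeds one
  fixed multiple of its standard deviation, \<open>sqrt (m/24)\<close>, with probability at least \<open>1/24\<close>,
  whatever \<open>m\<close> is (\<open>prob_S_ge_std\<close>).  Among the \<open>k\<close> variables choose \<open>j\<close> disjoint blocks of size \<open>m\<close>,
  with \<open>j * m\<close> of order \<open>k\<close>.  If every block sum reaches \<open>sqrt (m/24)\<close> and the leftover variables have a
  nonnegative sum, then \<open>S\<close> is at least \<open>j * sqrt (m/24)\<close>, which is of order \<open>sqrt (j * k)\<close>.  By
  independence this event has probability at least \<open>1/2 * (1/24) ^ j\<close> (\<open>prob_S_blocks\<close>).  Reaching \<open>x\<close>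
  takes \<open>j\<close> of order \<open>1 + x\<^sup>2 / k\<close>, so the bound is Gaussian in \<open>x\<close>; the blocks are nonempty as long as
  \<open>j \<le> k\<close>, which is what restricts \<open>x\<close> to a small multiple of \<open>k\<close> (\<open>prob_S_lower\<close>).
\<close>

section \<open>The uniform law and sums of independent variables\<close>

lemma prob_space_unif: "prob_space (uniform_measure lborel {0..1::real})"
  by (rule prob_space_uniform_measure) auto

lemma distr_reflect_uniform:
  "distr (uniform_measure lborel {0..1::real}) borel (\<lambda>u. 1 - u) = uniform_measure lborel {0..1}"
proof (rule measure_eqI)
  fix B assume "B \<in> sets (distr (uniform_measure lborel {0..1::real}) borel (\<lambda>u. 1 - u))"
  then have B [measurable]: "B \<in> sets borel" by simp
  have refl: "distr lborel borel (\<lambda>u::real. 1 - u) = lborel"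
    using lborel_real_affine[of "-1" 1] by (simp add: density_1)
  have "(\<lambda>u::real. 1 - u) -` B \<inter> space lborel \<in> sets lborel"
    by (rule measurable_sets[where A=borel]) (auto simp: measurable_lborel1)
  then have [measurable]: "(\<lambda>u::real. 1 - u) -` B \<in> sets borel"
    by simp
  have "emeasure (distr (uniform_measure lborel {0..1::real}) borel (\<lambda>u. 1 - u)) B
      = emeasure lborel ({0..1} \<inter> (\<lambda>u. 1 - u) -` B)"
    by (subst emeasure_distr) (auto simp: emeasure_uniform_measure divide_ennreal_def)
  also have "{0..1} \<inter> (\<lambda>u. 1 - u) -` B = (\<lambda>u::real. 1 - u) -` ({0..1} \<inter> B) \<inter> space lborel"
    by auto
  also have "emeasure lborel \<dots> = emeasure (distr lborel borel (\<lambda>u::real. 1 - u)) ({0..1} \<inter> B)"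
    by (subst emeasure_distr) auto
  also have "\<dots> = emeasure (uniform_measure lborel {0..1::real}) B"
    unfolding refl by (simp add: emeasure_uniform_measure divide_ennreal_def)
  finally show "emeasure (distr (uniform_measure lborel {0..1::real}) borel (\<lambda>u. 1 - u)) B
      = emeasure (uniform_measure lborel {0..1::real}) B" .
qed simp

text \<open>
  Independence makes the joint law the product of the marginal laws, so the law of the sum is
  determined by the latter.
\<close>

lemma (in prob_space) distr_sum_indep_cong:
  fixes X Y :: "'i \<Rightarrow> 'a \<Rightarrow> real"
  assumes "indep_vars (\<lambda>_. borel) X A" "indep_vars (\<lambda>_. borel) Y A"
    and law: "\<And>i. i \<in> A \<Longrightarrow> distr M borel (X i) = distr M borel (Y i)"
  shows "distr M borel (\<lambda>\<omega>. \<Sum>i\<in>A. X i \<omega>) = distr M borel (\<lambda>\<omega>. \<Sum>i\<in>A. Y i \<omega>)"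
proof (cases "A = {}")
  case False
  have sum_law: "distr M borel (\<lambda>\<omega>. \<Sum>i\<in>A. Z i \<omega>)
      = distr (\<Pi>\<^sub>M i\<in>A. distr M borel (Z i)) borel (\<lambda>z. \<Sum>i\<in>A. z i)"
    if ind: "indep_vars (\<lambda>_. borel) Z A" for Z :: "'i \<Rightarrow> 'a \<Rightarrow> real"
  proof -
    have rv: "random_variable borel (Z i)" if "i \<in> A" for i
      using ind that by (auto simp: indep_vars_def)
    have "distr M borel (\<lambda>\<omega>. \<Sum>i\<in>A. Z i \<omega>)
        = distr M borel ((\<lambda>z. \<Sum>i\<in>A. z i) \<circ> (\<lambda>\<omega>. \<lambda>i\<in>A. Z i \<omega>))"
      by (intro distr_cong) auto
    also have "\<dots> = distr (distr M (\<Pi>\<^sub>M i\<in>A. borel) (\<lambda>\<omega>. \<lambda>i\<in>A. Z i \<omega>)) borel (\<lambda>z. \<Sum>i\<in>A. z i)"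
      using rv by (intro distr_distr[symmetric] measurable_restrict) auto
    also have "distr M (\<Pi>\<^sub>M i\<in>A. borel) (\<lambda>\<omega>. \<lambda>i\<in>A. Z i \<omega>) = (\<Pi>\<^sub>M i\<in>A. distr M borel (Z i))"
      using indep_vars_iff_distr_eq_PiM'[OF False, of Z "\<lambda>_. borel"] rv ind by blast
    finally show ?thesis .
  qed
  have "(\<Pi>\<^sub>M i\<in>A. distr M borel (X i)) = (\<Pi>\<^sub>M i\<in>A. distr M borel (Y i))"
    by (intro PiM_cong) (auto simp: law)
  with sum_law assms(1,2) show ?thesis by simp
qed simp

section \<open>Centred sums of uniform variables and their symmetry\<close>

text \<open>
  The sums range over arbitrary finite sets of indices, so that every statement applies to the whole
  sample as well as to the blocks into which it is cut.
\<close>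

locale uniform_sample = prob_space +
  fixes U :: "'i \<Rightarrow> 'a \<Rightarrow> real" and I :: "'i set"
  assumes indep: "indep_vars (\<lambda>_. borel) U I"
    and unif: "\<And>i. i \<in> I \<Longrightarrow> distr M borel (U i) = uniform_measure lborel {0..1}"
begin

definition S :: "'i set \<Rightarrow> 'a \<Rightarrow> real" where
  "S A \<omega> = (\<Sum>i\<in>A. U i \<omega> - 1 / 2)"

lemma rv [measurable]: "i \<in> I \<Longrightarrow> random_variable borel (U i)"
  using indep by (auto simp: indep_vars_def)

lemma S_rv: "A \<subseteq> I \<Longrightarrow> random_variable borel (S A)"
  unfolding S_def[abs_def] by (intro borel_measurable_sum borel_measurable_diff) auto

lemma indep_centred:
  assumes "A \<subseteq> I"
  shows "indep_vars (\<lambda>_. borel) (\<lambda>i \<omega>. U i \<omega> - 1/2) A"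
  using indep_vars_compose2[OF indep_vars_subset[OF indep assms], of "\<lambda>_ u. u - 1/2" "\<lambda>_. borel"]
  by simp

lemma indep_S:
  assumes "finite A" "finite B" "A \<inter> B = {}" "A \<subseteq> I" "B \<subseteq> I"
  shows "indep_var borel (S A) borel (S B)"
proof -
  have "indep_var borel ((\<lambda>u. \<Sum>i\<in>A. u i - 1/2) \<circ> (\<lambda>\<omega>. restrict (\<lambda>i. U i \<omega>) A))
     borel ((\<lambda>u. \<Sum>i\<in>B. u i - 1/2) \<circ> (\<lambda>\<omega>. restrict (\<lambda>i. U i \<omega>) B))"
    using assms by (intro indep_var_compose[OF indep_var_restrict[OF indep]]) auto
  also have "(\<lambda>u. \<Sum>i\<in>A. u i - 1/2) \<circ> (\<lambda>\<omega>. restrict (\<lambda>i. U i \<omega>) A) = S A"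
    by (auto simp: S_def fun_eq_iff)
  also have "(\<lambda>u. \<Sum>i\<in>B. u i - 1/2) \<circ> (\<lambda>\<omega>. restrict (\<lambda>i. U i \<omega>) B) = S B"
    by (auto simp: S_def fun_eq_iff)
  finally show ?thesis .
qed

text \<open>Negating the centred sum amounts to replacing every \<open>U i\<close> by \<open>1 - U i\<close>, which is again uniform.\<close>

lemma distr_uminus_S:
  assumes "A \<subseteq> I"
  shows "distr M borel (\<lambda>\<omega>. - S A \<omega>) = distr M borel (S A)"
proof -
  have "distr M borel (\<lambda>\<omega>. 1/2 - U i \<omega>) = distr M borel (\<lambda>\<omega>. U i \<omega> - 1/2)" if "i \<in> A" for i
  proof -
    have i: "i \<in> I" using that assms by auto
    have "distr M borel (\<lambda>\<omega>. 1/2 - U i \<omega>) = distr (distr M borel (U i)) borel (\<lambda>u. 1/2 - u)"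
      using i by (subst distr_distr) (auto simp: comp_def)
    also have "\<dots> = distr (uniform_measure lborel {0..1}) borel (\<lambda>u. (1 - u) - 1/2)"
      using i by (simp add: unif)
    also have "\<dots> = distr (distr (uniform_measure lborel {0..1}) borel (\<lambda>u. 1 - u)) borel (\<lambda>u. u - 1/2)"
      by (subst distr_distr) (auto simp: comp_def)
    also have "\<dots> = distr (distr M borel (U i)) borel (\<lambda>u. u - 1/2)"
      using i by (simp add: unif distr_reflect_uniform)
    also have "\<dots> = distr M borel (\<lambda>\<omega>. U i \<omega> - 1/2)"
      using i by (subst distr_distr) (auto simp: comp_def)
    finally show ?thesis .
  qed
  moreover have "indep_vars (\<lambda>_. borel) (\<lambda>i \<omega>. 1/2 - U i \<omega>) A"
    using indep_vars_compose2[OF indep_vars_subset[OF indep assms], of "\<lambda>_ u. 1/2 - u" "\<lambda>_. borel"]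
    by simp
  ultimately have "distr M borel (\<lambda>\<omega>. \<Sum>i\<in>A. 1/2 - U i \<omega>) = distr M borel (\<lambda>\<omega>. \<Sum>i\<in>A. U i \<omega> - 1/2)"
    using indep_centred[OF assms] by (intro distr_sum_indep_cong) auto
  moreover have "(\<Sum>i\<in>A. 1/2 - U i \<omega>) = - S A \<omega>" for \<omega>
    by (simp add: S_def flip: sum_negf)
  ultimately show ?thesis by (simp add: S_def[abs_def])
qed

lemma prob_S_symmetric:
  assumes "A \<subseteq> I"
  shows "\<P>(\<omega> in M. S A \<omega> \<le> - s) = \<P>(\<omega> in M. S A \<omega> \<ge> s)"
proof -
  have [measurable]: "random_variable borel (S A)" by (rule S_rv) fact
  have "\<P>(\<omega> in M. S A \<omega> \<le> - s) = measure (distr M borel (\<lambda>\<omega>. - S A \<omega>)) {s..}"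
    by (subst measure_distr) (auto intro!: arg_cong[where f=prob])
  also have "\<dots> = \<P>(\<omega> in M. S A \<omega> \<ge> s)"
    unfolding distr_uminus_S[OF assms]
    by (subst measure_distr) (auto intro!: arg_cong[where f=prob])
  finally show ?thesis .
qed

section \<open>Second and fourth moments\<close>

lemma AE_bounds:
  assumes i: "i \<in> I"
  shows "AE \<omega> in M. 0 \<le> U i \<omega> \<and> U i \<omega> \<le> 1"
proof -
  have "AE u in uniform_measure lborel {0..1::real}. 0 \<le> u \<and> u \<le> 1"
    by (rule AE_uniform_measureI) auto
  then have "AE u in distr M borel (U i). 0 \<le> u \<and> u \<le> 1" using i by (simp only: unif)
  then show ?thesis using i by (subst (asm) AE_distr_iff) auto
qed

lemma expectation_uniform:
  assumes i: "i \<in> I" and [measurable]: "f \<in> borel_measurable borel"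
  shows "expectation (\<lambda>\<omega>. f (U i \<omega>)) = (\<integral>u. f u * indicator {0..1} u \<partial>lborel :: real)"
proof -
  have "expectation (\<lambda>\<omega>. f (U i \<omega>)) = integral\<^sup>L (distr M borel (U i)) f"
    using i by (subst integral_distr) auto
  also have "\<dots> = integral\<^sup>L (density lborel (\<lambda>u. ennreal (indicator {0..1} u))) f"
    using i by (simp add: unif uniform_measure_def divide_ennreal_def ennreal_indicator)
  also have "\<dots> = (\<integral>u. f u * indicator {0..1} u \<partial>lborel)"
    by (subst integral_density) (auto simp: mult.commute)
  finally show ?thesis .
qed

lemma centred_moment:
  assumes i: "i \<in> I"
  shows "expectation (\<lambda>\<omega>. (U i \<omega> - 1/2) ^ p) = ((1/2) ^ Suc p - (- 1/2) ^ Suc p) / Suc p"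
proof -
  have "expectation (\<lambda>\<omega>. (U i \<omega> - 1/2) ^ p) = (\<integral>u. (u - 1/2) ^ p * indicator {0..1} u \<partial>lborel)"
    using i by (rule expectation_uniform) simp
  also have "\<dots> = (1 - 1/2) ^ Suc p / Suc p - (0 - 1/2) ^ Suc p / Suc p"
  proof (rule integral_FTC_Icc_real)
    fix u :: real
    show "DERIV (\<lambda>u. (u - 1/2) ^ Suc p / Suc p) u :> (u - 1/2) ^ p"
      by (rule derivative_eq_intros refl | simp)+
  qed (auto intro!: continuous_intros)
  finally show ?thesis by (simp add: diff_divide_distrib[symmetric] del: power_Suc)
qed

lemma S_bound:
  assumes A: "A \<subseteq> I" "finite A"
  shows "AE \<omega> in M. \<bar>S A \<omega>\<bar> \<le> card A / 2"
proof -
  have "AE \<omega> in M. \<forall>i\<in>A. 0 \<le> U i \<omega> \<and> U i \<omega> \<le> 1"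
    using A AE_bounds by (intro AE_finite_allI) auto
  then show ?thesis
  proof eventually_elim
    case (elim \<omega>)
    have "\<bar>S A \<omega>\<bar> \<le> (\<Sum>i\<in>A. \<bar>U i \<omega> - 1/2\<bar>)" unfolding S_def by (rule sum_abs)
    also have "\<dots> \<le> (\<Sum>i\<in>A. 1/2)" using elim by (intro sum_mono) (auto simp: abs_if)
    finally show ?case by simp
  qed
qed

lemma integrable_S_power:
  assumes "A \<subseteq> I" "finite A"
  shows "integrable M (\<lambda>\<omega>. S A \<omega> ^ p)"
proof (rule integrable_const_bound[where B="(card A / 2) ^ p"])
  show "AE \<omega> in M. norm (S A \<omega> ^ p) \<le> (card A / 2) ^ p"
    using S_bound[OF assms] by eventually_elim (auto simp: power_abs intro!: power_mono)
  show "random_variable borel (\<lambda>\<omega>. S A \<omega> ^ p)"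
    using S_rv[OF assms(1)] by simp
qed

lemma expectation_S_power_mult:
  assumes "finite A" "finite B" "A \<inter> B = {}" "A \<subseteq> I" "B \<subseteq> I"
  shows "expectation (\<lambda>\<omega>. S A \<omega> ^ p * S B \<omega> ^ q)
      = expectation (\<lambda>\<omega>. S A \<omega> ^ p) * expectation (\<lambda>\<omega>. S B \<omega> ^ q)"
    and "integrable M (\<lambda>\<omega>. S A \<omega> ^ p * S B \<omega> ^ q)"
proof -
  have ind: "indep_var borel (\<lambda>\<omega>. S A \<omega> ^ p) borel (\<lambda>\<omega>. S B \<omega> ^ q)"
    using indep_var_compose[OF indep_S[OF assms], of "\<lambda>x. x ^ p" borel "\<lambda>x. x ^ q" borel]
    by (simp add: comp_def)
  show "expectation (\<lambda>\<omega>. S A \<omega> ^ p * S B \<omega> ^ q)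
      = expectation (\<lambda>\<omega>. S A \<omega> ^ p) * expectation (\<lambda>\<omega>. S B \<omega> ^ q)"
    using ind assms by (intro indep_var_lebesgue_integral integrable_S_power) auto
  show "integrable M (\<lambda>\<omega>. S A \<omega> ^ p * S B \<omega> ^ q)"
    using ind assms by (intro indep_var_integrable integrable_S_power) auto
qed

text \<open>
  Add one variable \<open>V\<close> at a time.  In the expansions of \<open>(S + V)\<^sup>2\<close> and \<open>(S + V) ^ 4\<close> the terms with an
  odd power of \<open>V\<close> have expectation zero, so the fourth moment grows by \<open>6 * n/12 * 1/12 + 1/80\<close> when
  \<open>S\<close> has \<open>n\<close> terms.  This is at most \<open>((n + 1)\<^sup>2 - n\<^sup>2) / 48\<close>, which explains the constant: in this
  form the bound is preserved exactly, up to \<open>1/80 \<le> 1/48\<close>.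
\<close>

lemma moments_S:
  assumes "finite A" "A \<subseteq> I"
  shows "expectation (\<lambda>\<omega>. S A \<omega> ^ 2) = card A / 12 \<and>
         expectation (\<lambda>\<omega>. S A \<omega> ^ 4) \<le> (card A)\<^sup>2 / 48"
  using assms
proof (induction A rule: finite_induct)
  case empty
  then show ?case by (simp add: S_def)
next
  case (insert i A)
  have A: "finite A" "finite {i}" "A \<inter> {i} = {}" "A \<subseteq> I" "{i} \<subseteq> I" using insert by auto
  \<comment> \<open>an opaque name for the mixed monomials, so that linearity of expectation stops at them\<close>
  define T where "T p q \<omega> = S A \<omega> ^ p * S {i} \<omega> ^ q" for p q :: nat and \<omega>
  note fact = expectation_S_power_mult[OF A]
  have m: "expectation (\<lambda>\<omega>. S {i} \<omega> ^ p) = ((1/2) ^ Suc p - (- 1/2) ^ Suc p) / Suc p" for p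
    using centred_moment[of i p] insert.prems by (simp add: S_def)
  have T_int: "integrable M (T p q)" for p q
    using fact(2) by (simp add: T_def[abs_def])
  have T_exp: "expectation (T p q) = expectation (\<lambda>\<omega>. S A \<omega> ^ p) * expectation (\<lambda>\<omega>. S {i} \<omega> ^ q)" for p q
    using fact(1) by (simp add: T_def[abs_def])
  have S: "S (insert i A) \<omega> = S A \<omega> + S {i} \<omega>" for \<omega>
    using insert by (simp add: S_def)
  have "expectation (\<lambda>\<omega>. S (insert i A) \<omega> ^ 2)
      = expectation (\<lambda>\<omega>. T 2 0 \<omega> + 2 * (T 1 1 \<omega>) + T 0 2 \<omega>)"
    unfolding S by (intro Bochner_Integration.integral_cong) (auto simp: T_def power2_eq_square algebra_simps)
  also have "\<dots> = expectation (T 2 0) + 2 * expectation (T 1 1) + expectation (T 0 2)"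
    using T_int by simp
  also have "\<dots> = card A / 12 + 1 / 12"
    unfolding T_exp m using insert by (simp add: prob_space eval_nat_numeral)
  finally have 2: "expectation (\<lambda>\<omega>. S (insert i A) \<omega> ^ 2) = card (insert i A) / 12"
    using insert by simp
  have "expectation (\<lambda>\<omega>. S (insert i A) \<omega> ^ 4)
      = expectation (\<lambda>\<omega>. T 4 0 \<omega> + 4 * (T 3 1 \<omega>)
         + 6 * (T 2 2 \<omega>) + 4 * (T 1 3 \<omega>) + T 0 4 \<omega>)"
    unfolding S by (intro Bochner_Integration.integral_cong) (auto simp: T_def eval_nat_numeral algebra_simps)
  also have "\<dots> = expectation (T 4 0) + 4 * expectation (T 3 1) + 6 * expectation (T 2 2)
      + 4 * expectation (T 1 3) + expectation (T 0 4)"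
    using T_int by simp
  also have "\<dots> = expectation (\<lambda>\<omega>. S A \<omega> ^ 4) + card A / 24 + 1 / 80"
    unfolding T_exp m using insert by (simp add: prob_space eval_nat_numeral)
  also have "\<dots> \<le> (card A)\<^sup>2 / 48 + card A / 24 + 1 / 48"
    using insert by simp
  also have "\<dots> = (card (insert i A))\<^sup>2 / 48"
    using insert by (simp add: power2_eq_square field_simps)
  finally show ?case using 2 by simp
qed

section \<open>The lower bound\<close>

text \<open>
  A second-moment argument in the style of Paley and Zygmund.  For \<open>w = S\<^sup>2 / n\<close>, the quadratic
  \<open>4 * (w - 1/24 - w\<^sup>2)\<close> is at most \<open>1\<close> everywhere and at most \<open>0\<close> for \<open>w \<le> 1/24\<close>, hence it lies
  below the indicator of \<open>w \<ge> 1/24\<close>; its expectation is at least \<open>4 * (1/12 - 1/24 - 1/48) = 1/12\<close>.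
  By symmetry the right tail has at least half of this probability.
\<close>

lemma prob_S_ge_std:
  assumes A: "finite A" "A \<subseteq> I" "A \<noteq> {}"
  shows "\<P>(\<omega> in M. S A \<omega> \<ge> sqrt (card A / 24)) \<ge> 1 / 24"
proof -
  define n where "n = real (card A)"
  have n: "n > 0" using A by (auto simp: n_def card_gt_0_iff)
  have [measurable]: "random_variable borel (S A)" by (rule S_rv) fact
  define s where "s = sqrt (n / 24)"
  have s: "s > 0" "s\<^sup>2 = n / 24" using n by (auto simp: s_def)
  let ?f = "\<lambda>\<omega>. 4 * (S A \<omega> ^ 2 / n - 1 / 24 - S A \<omega> ^ 4 / n\<^sup>2)"
  have int: "integrable M (\<lambda>\<omega>. S A \<omega> ^ p)" for p
    using A by (intro integrable_S_power) auto
  have "1 / 12 = 4 * (n / 12 / n - 1 / 24 - n\<^sup>2 / 48 / n\<^sup>2)"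
    using n by simp
  also have "\<dots> \<le> 4 * (expectation (\<lambda>\<omega>. S A \<omega> ^ 2) / n - 1 / 24 - expectation (\<lambda>\<omega>. S A \<omega> ^ 4) / n\<^sup>2)"
    using moments_S[OF A(1,2)] n
    by (intro mult_left_mono diff_mono divide_right_mono) (auto simp: n_def)
  also have "\<dots> = expectation ?f"
    using int by (simp add: prob_space)
  also have "\<dots> \<le> expectation (\<lambda>\<omega>. indicator {\<omega>\<in>space M. S A \<omega> \<le> - s \<or> S A \<omega> \<ge> s} \<omega>)"
  proof (rule integral_mono)
    show "integrable M ?f" using int by simp
    fix \<omega> assume \<omega>: "\<omega> \<in> space M"
    define w where "w = S A \<omega> ^ 2 / n"
    have f: "?f \<omega> = 4 * (w - 1 / 24 - w\<^sup>2)"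
      by (simp add: w_def power_divide flip: power_mult)
    show "?f \<omega> \<le> indicator {\<omega>\<in>space M. S A \<omega> \<le> - s \<or> S A \<omega> \<ge> s} \<omega>"
    proof (cases "S A \<omega> \<le> - s \<or> S A \<omega> \<ge> s")
      case True
      have "0 \<le> (w - 1/2)\<^sup>2" by simp
      then have "4 * (w - 1 / 24 - w\<^sup>2) \<le> 1" by (simp add: power2_eq_square algebra_simps)
      then show ?thesis unfolding f using True \<omega> by simp
    next
      case False
      then have "\<bar>S A \<omega>\<bar> \<le> s" by auto
      then have "S A \<omega> ^ 2 \<le> n / 24" using power_mono[of "\<bar>S A \<omega>\<bar>" s 2] s by simp
      then have "w \<le> 1 / 24" using n by (simp add: w_def field_simps)
      then have "w - 1 / 24 - w\<^sup>2 \<le> 0" using zero_le_power2[of w] by linarith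
      then show ?thesis unfolding f using False by simp
    qed
  qed (auto intro!: integrable_real_indicator simp: less_top[symmetric])
  also have "\<dots> = \<P>(\<omega> in M. S A \<omega> \<le> - s \<or> S A \<omega> \<ge> s)"
    by (auto intro!: arg_cong[where f=prob])
  also have "\<dots> \<le> prob ({\<omega>\<in>space M. S A \<omega> \<le> - s} \<union> {\<omega>\<in>space M. S A \<omega> \<ge> s})"
    by (intro finite_measure_mono) auto
  also have "\<dots> \<le> \<P>(\<omega> in M. S A \<omega> \<le> - s) + \<P>(\<omega> in M. S A \<omega> \<ge> s)"
    by (intro measure_Un_le) auto
  finally show ?thesis
    using prob_S_symmetric[OF A(2), of s] by (simp add: s_def n_def)
qed

lemma prob_S_nonneg:
  assumes A: "A \<subseteq> I"
  shows "\<P>(\<omega> in M. S A \<omega> \<ge> 0) \<ge> 1 / 2"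
proof -
  have [measurable]: "random_variable borel (S A)" by (rule S_rv) fact
  have "1 = prob ({\<omega>\<in>space M. S A \<omega> \<le> - 0} \<union> {\<omega>\<in>space M. S A \<omega> \<ge> 0})"
    by (subst prob_space[symmetric]) (auto intro!: arg_cong[where f=prob])
  also have "\<dots> \<le> \<P>(\<omega> in M. S A \<omega> \<le> - 0) + \<P>(\<omega> in M. S A \<omega> \<ge> 0)"
    by (intro measure_Un_le) auto
  finally show ?thesis
    using prob_S_symmetric[OF A, of 0] by simp
qed

lemma prob_S_superadditive:
  assumes AB: "finite A" "finite B" "A \<inter> B = {}" "A \<subseteq> I" "B \<subseteq> I"
  shows "\<P>(\<omega> in M. S A \<omega> \<ge> s) * \<P>(\<omega> in M. S B \<omega> \<ge> t) \<le> \<P>(\<omega> in M. S (A \<union> B) \<omega> \<ge> s + t)"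
proof -
  have [measurable]: "random_variable borel (S (A \<union> B))" using AB by (intro S_rv) auto
  have S: "S (A \<union> B) \<omega> = S A \<omega> + S B \<omega>" for \<omega>
    unfolding S_def using AB by (intro sum.union_disjoint) auto
  have "\<P>(\<omega> in M. S A \<omega> \<ge> s) * \<P>(\<omega> in M. S B \<omega> \<ge> t)
      = prob (S A -` {s..} \<inter> space M) * prob (S B -` {t..} \<inter> space M)"
    by (intro arg_cong2[where f="(*)"] arg_cong[where f=prob]) auto
  also have "\<dots> = prob ((\<lambda>\<omega>. (S A \<omega>, S B \<omega>)) -` ({s..} \<times> {t..}) \<inter> space M)"
    by (rule indep_varD[OF indep_S[OF AB], symmetric]) auto
  also have "\<dots> \<le> \<P>(\<omega> in M. S (A \<union> B) \<omega> \<ge> s + t)"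
  proof (rule finite_measure_mono)
    show "(\<lambda>\<omega>. (S A \<omega>, S B \<omega>)) -` ({s..} \<times> {t..}) \<inter> space M \<subseteq> {\<omega>\<in>space M. S (A \<union> B) \<omega> \<ge> s + t}"
      by (auto simp: S)
  qed simp
  finally show ?thesis .
qed

text \<open>
  The factor \<open>1/2\<close> pays for the variables outside the \<open>j\<close> blocks, whose sum is only asked to be
  nonnegative; their number may be zero.
\<close>

lemma prob_S_blocks:
  assumes "finite A" "A \<subseteq> I" "m \<ge> 1" "j * m \<le> card A"
  shows "\<P>(\<omega> in M. S A \<omega> \<ge> j * sqrt (m / 24)) \<ge> 1 / 2 * (1 / 24 :: real) ^ j"
  using assms
proof (induction j arbitrary: A)
  case 0
  then show ?case using prob_S_nonneg[of A] by simp
next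
  case (Suc j)
  have "m \<le> card A" using Suc.prems by simp
  then obtain B where B: "B \<subseteq> A" "card B = m" "finite B"
    using Suc.prems by (meson obtain_subset_with_card_n)
  have BI: "B \<subseteq> I" "A - B \<subseteq> I" "B \<noteq> {}" "B \<union> (A - B) = A" using B Suc.prems by auto
  have "j * m \<le> card (A - B)" using B Suc.prems by (simp add: card_Diff_subset)
  then have IH: "1 / 2 * (1 / 24) ^ j \<le> \<P>(\<omega> in M. S (A - B) \<omega> \<ge> j * sqrt (m / 24))"
    using Suc.IH[of "A - B"] Suc.prems BI by auto
  have "1 / 2 * (1 / 24 :: real) ^ Suc j = 1 / 24 * (1 / 2 * (1 / 24) ^ j)" by simp
  also have "\<dots> \<le> \<P>(\<omega> in M. S B \<omega> \<ge> sqrt (m / 24)) * \<P>(\<omega> in M. S (A - B) \<omega> \<ge> j * sqrt (m / 24))"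
    using prob_S_ge_std[of B] B BI IH by (intro mult_mono) auto
  also have "\<dots> \<le> \<P>(\<omega> in M. S (B \<union> (A - B)) \<omega> \<ge> sqrt (m / 24) + j * sqrt (m / 24))"
    using B BI Suc.prems by (intro prob_S_superadditive) auto
  finally show ?case using BI by (simp add: algebra_simps)
qed

text \<open>
  With \<open>m = k div j\<close> one has \<open>m \<ge> k / (2 * j)\<close>, so \<open>j * sqrt (m/24) \<ge> x\<close> as soon as
  \<open>j \<ge> 48 * x\<^sup>2 / k\<close>.  For \<open>x \<le> k/8\<close> the right-hand side is at most \<open>3/4 * k\<close>, and this leaves room for
  rounding up to an integer \<open>j\<close> between \<open>1\<close> and \<open>k\<close>.
\<close>

lemma prob_S_lower:
  fixes x :: real
  assumes A: "finite A" "A \<subseteq> I" "A \<noteq> {}" and x: "0 \<le> x" "x \<le> 1 / 8 * card A"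
  shows "\<P>(\<omega> in M. S A \<omega> \<ge> x) \<ge> 1 / 48 * exp (- (48 * ln 24) * (x\<^sup>2 / card A))"
proof -
  define k where "k = card A"
  define y where "y = 48 * x\<^sup>2 / real k"
  define j where "j = nat \<lfloor>y\<rfloor> + 1"
  define m where "m = k div j"
  have k: "k > 0" using A by (simp add: k_def card_gt_0_iff)
  have y0: "y \<ge> 0" by (simp add: y_def)
  have y: "y < real j" "real j \<le> y + 1" using y0 by (auto simp: j_def) linarith+
  have "x\<^sup>2 \<le> (1 / 8 * real k)\<^sup>2" using x by (intro power_mono) (auto simp: k_def)
  then have "y \<le> 48 * (1 / 8 * real k)\<^sup>2 / real k"
    unfolding y_def by (intro divide_right_mono) auto
  also have "\<dots> < real k" using k by (simp add: power2_eq_square)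
  \<comment> \<open>the strict inequality matters here: it gives \<open>j \<le> k\<close> rather than \<open>j \<le> k + 1\<close>\<close>
  finally have "real j < real k + 1" using y by linarith
  then have jk: "j \<le> k" by linarith
  have j1: "j \<ge> 1" by (simp add: j_def)
  have m1: "m \<ge> 1" using jk j1 unfolding m_def by (simp add: div_greater_zero_iff Suc_le_eq)
  have "k < j * (m + 1)" using j1 unfolding m_def
    by (metis Suc_eq_plus1 dividend_less_times_div less_eq_Suc_le mult.commute mult_Suc_right
        One_nat_def add.commute)
  also have "\<dots> \<le> j * (2 * m)" using m1 by (intro mult_left_mono) auto
  finally have "real k \<le> real (j * (2 * m))" by linarith
  then have km: "real k \<le> 2 * (real j * real m)" by simp
  have "x\<^sup>2 * 48 = y * real k" using k by (simp add: y_def)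
  also have "\<dots> \<le> real j * (2 * (real j * real m))" using y y0 km by (intro mult_mono) auto
  finally have "x\<^sup>2 \<le> (real j * sqrt (m / 24))\<^sup>2"
    by (simp add: power_mult_distrib) (simp add: power2_eq_square)
  then have xj: "x \<le> real j * sqrt (m / 24)" by (rule power2_le_imp_le) auto
  have [measurable]: "random_variable borel (S A)" by (rule S_rv) fact
  have "1 / 48 * exp (- (48 * ln 24) * (x\<^sup>2 / card A)) = 1 / 2 * (exp (- ln 24) * exp (- ln 24 * y))"
    by (simp add: exp_minus y_def k_def field_simps)
  also have "\<dots> = 1 / 2 * exp (- ln 24 * (y + 1))"
    by (simp add: algebra_simps flip: exp_add)
  also have "\<dots> \<le> 1 / 2 * exp (- ln 24 * real j)"
    using y by simp
  also have "\<dots> = 1 / 2 * (1 / 24) ^ j"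
    by (simp add: exp_minus exp_of_nat2_mult power_one_over inverse_eq_divide)
  also have "\<dots> \<le> \<P>(\<omega> in M. S A \<omega> \<ge> j * sqrt (m / 24))"
    using A m1 by (intro prob_S_blocks) (auto simp: m_def k_def)
  also have "\<dots> \<le> \<P>(\<omega> in M. S A \<omega> \<ge> x)"
    using xj by (intro finite_measure_mono) auto
  finally show ?thesis .
qed


section \<open>The upper bound\<close>

text \<open>
  The chord of \<open>v \<mapsto> exp (l v)\<close> over \<open>[-1/2, 1/2]\<close> takes the value \<open>cosh (l/2)\<close> at \<open>v = 0\<close>, and it is
  affine, so its expectation is its value at the mean.
\<close>

lemma mgf_centred_le:
  assumes i: "i \<in> I"
  shows "expectation (\<lambda>\<omega>. exp (l * (U i \<omega> - 1/2))) \<le> cosh (l / 2)"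
    and "integrable M (\<lambda>\<omega>. exp (l * (U i \<omega> - 1/2)))"
proof -
  have [measurable]: "random_variable borel (U i)" using i by (rule rv)
  let ?chord = "\<lambda>\<omega>. cosh (l / 2) + (U i \<omega> - 1/2) * (exp (l / 2) - exp (- (l / 2)))"
  have chord: "AE \<omega> in M. exp (l * (U i \<omega> - 1/2)) \<le> ?chord \<omega>"
    using AE_bounds[OF i]
  proof eventually_elim
    case (elim \<omega>)
    have mix: "(1 - U i \<omega>) *\<^sub>R (- (l / 2)) + U i \<omega> *\<^sub>R (l / 2) = l * (U i \<omega> - 1/2)"
      by (simp add: field_simps)
    have "exp ((1 - U i \<omega>) *\<^sub>R (- (l / 2)) + U i \<omega> *\<^sub>R (l / 2))
        \<le> (1 - U i \<omega>) * exp (- (l / 2)) + U i \<omega> * exp (l / 2)"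
      using elim by (intro convex_onD[OF exp_convex]) auto
    then show ?case unfolding mix by (simp add: cosh_field_def field_simps)
  qed
  have U1: "integrable M (U i)"
    using AE_bounds[OF i] by (intro integrable_const_bound[where B=1]) auto
  show int: "integrable M (\<lambda>\<omega>. exp (l * (U i \<omega> - 1/2)))"
  proof (rule Bochner_Integration.integrable_bound)
    show "integrable M ?chord" using U1 by simp
    show "AE \<omega> in M. norm (exp (l * (U i \<omega> - 1/2))) \<le> norm (?chord \<omega>)"
      using chord by eventually_elim auto
  qed simp
  have "expectation (\<lambda>\<omega>. exp (l * (U i \<omega> - 1/2))) \<le> expectation ?chord"
    using chord int U1 by (intro integral_mono_AE) auto
  also have "\<dots> = cosh (l / 2) + expectation (\<lambda>\<omega>. U i \<omega> - 1/2) * (exp (l / 2) - exp (- (l / 2)))"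
    using U1 by (simp add: prob_space)
  also have "expectation (\<lambda>\<omega>. U i \<omega> - 1/2) = 0"
    using centred_moment[OF i, of 1] by simp
  finally show "expectation (\<lambda>\<omega>. exp (l * (U i \<omega> - 1/2))) \<le> cosh (l / 2)" by simp
qed

lemma prob_S_chernoff:
  fixes l x :: real
  assumes A: "finite A" "A \<subseteq> I" and l: "l \<ge> 0"
  shows "\<P>(\<omega> in M. S A \<omega> \<ge> x) \<le> exp (- (l * x)) * cosh (l / 2) ^ card A"
proof -
  have [measurable]: "random_variable borel (S A)" by (rule S_rv) fact
  let ?e = "\<lambda>i \<omega>. exp (l * (U i \<omega> - 1/2))"
  have exp_S: "exp (l * S A \<omega>) = (\<Prod>i\<in>A. ?e i \<omega>)" for \<omega>
    using A by (simp add: S_def sum_distrib_left exp_sum)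
  have ind: "indep_vars (\<lambda>_. borel) ?e A"
    using indep_vars_compose2[OF indep_centred[OF A(2)], of "\<lambda>_ v. exp (l * v)" "\<lambda>_. borel"]
    by simp
  have int: "integrable M (?e i)" if "i \<in> A" for i
    using that A by (intro mgf_centred_le) auto
  have "expectation (\<lambda>\<omega>. exp (l * S A \<omega>)) = (\<Prod>i\<in>A. expectation (?e i))"
    unfolding exp_S using A ind int by (intro indep_vars_lebesgue_integral) auto
  also have "\<dots> \<le> (\<Prod>i\<in>A. cosh (l / 2))"
    using A by (intro prod_mono conjI mgf_centred_le) auto
  finally have mgf: "expectation (\<lambda>\<omega>. exp (l * S A \<omega>)) \<le> cosh (l / 2) ^ card A"
    by simp
  have "\<P>(\<omega> in M. S A \<omega> \<ge> x) \<le> \<P>(\<omega> in M. exp (l * S A \<omega>) \<ge> exp (l * x))"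
    using l by (intro finite_measure_mono) (auto intro: mult_left_mono)
  also have "\<dots> \<le> expectation (\<lambda>\<omega>. exp (l * S A \<omega>)) / exp (l * x)"
    using indep_vars_integrable[OF A(1) ind int]
    by (intro integral_Markov_inequality_measure[where A="{}"]) (simp_all add: exp_S prod_nonneg)
  also have "\<dots> \<le> cosh (l / 2) ^ card A / exp (l * x)"
    using mgf by (rule divide_right_mono) simp
  also have "\<dots> = exp (- (l * x)) * cosh (l / 2) ^ card A"
    by (simp add: exp_minus field_simps)
  finally show ?thesis .
qed

text \<open>
  Put \<open>t = x / k\<close>, \<open>a = 1/2 + t\<close> and \<open>b = 1/2 - t\<close>.  The Chernoff bound is the \<open>k\<close>-th power of
  \<open>exp (- l t) * cosh (l/2)\<close>, which is smallest where \<open>tanh (l/2) = 2 * t\<close>, that is, at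
  \<open>l = ln (a / b)\<close>.  When \<open>t = 1/2\<close> the infimum is not attained and is reached as \<open>l\<close> tends to infinity.
\<close>

lemma prob_S_upper:
  fixes x :: real
  assumes A: "finite A" "A \<subseteq> I" "A \<noteq> {}" and x: "0 \<le> x" "x \<le> card A / 2"
  shows "\<P>(\<omega> in M. S A \<omega> \<ge> x) \<le> exp (- real (card A) * bernoulli_KL (1/2) (1/2 + x / card A))"
proof -
  define k where "k = card A"
  have k: "k > 0" using A by (simp add: k_def card_gt_0_iff)
  define t where "t = x / real k"
  have xt: "x = real k * t" using k by (simp add: t_def)
  have t: "0 \<le> t" "t \<le> 1/2" using x k by (auto simp: t_def k_def field_simps)
  have bound: "\<P>(\<omega> in M. S A \<omega> \<ge> x) \<le> (exp (- (l * t)) * cosh (l / 2)) ^ k" if "l \<ge> 0" for l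
  proof -
    have "exp (- (l * x)) = exp (- (l * t)) ^ k"
      by (simp add: xt mult.left_commute flip: exp_of_nat_mult)
    then show ?thesis
      using prob_S_chernoff[OF A(1,2) that, of x] by (simp add: k_def power_mult_distrib)
  qed
  have "\<P>(\<omega> in M. S A \<omega> \<ge> x) \<le> exp (- bernoulli_KL (1/2) (1/2 + t)) ^ k"
  proof (cases "t < 1/2")
    case True
    define a b where "a = 1/2 + t" and "b = 1/2 - t"
    have ab: "a > 0" "b > 0" "b \<le> a" "a + b = 1" using True t by (auto simp: a_def b_def)
    define l where "l = ln a - ln b"
    have half: "l / 2 = ln a + - (ln a + ln b) / 2" "- (l / 2) = ln b + - (ln a + ln b) / 2"
      by (simp_all add: l_def field_simps)
    have "cosh (l / 2) = (exp (ln a) + exp (ln b)) * exp (- (ln a + ln b) / 2) / 2"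
      unfolding cosh_field_def half(2) unfolding half(1) by (simp only: exp_add distrib_right)
    also have "\<dots> = exp (- (ln a + ln b) / 2 - ln 2)"
      using ab by (simp add: exp_diff)
    finally have "exp (- (l * t)) * cosh (l / 2) = exp (- (l * t) + (- (ln a + ln b) / 2 - ln 2))"
      by (simp only: exp_add)
    also have "- (l * t) + (- (ln a + ln b) / 2 - ln 2) = - (a * (ln a + ln 2) + b * (ln b + ln 2))"
    proof -
      have eq: "- ((p - q) * (r - 1/2)) + (- (p + q) / 2 - c) = - (r * (p + c) + (1 - r) * (q + c))"
        for p q r c :: real
        by (simp add: field_simps)
      have "a - 1/2 = t" "1 - a = b" by (simp_all add: a_def b_def)
      with eq[of "ln a" "ln b" a "ln 2"] show ?thesis by (simp only: l_def)
    qed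
    also have "a * (ln a + ln 2) + b * (ln b + ln 2) = bernoulli_KL (1/2) (1/2 + t)"
    proof -
      have b: "1 - a = b" using ab by simp
      show ?thesis
        unfolding bernoulli_KL_def a_def[symmetric] b using ab by (simp add: ln_mult)
    qed
    finally show ?thesis
      using bound[of l] ab by (simp add: l_def)
  next
    case False
    then have t: "t = 1/2" using t by simp
    have bound': "\<P>(\<omega> in M. S A \<omega> \<ge> x) \<le> ((1 + exp (- l)) / 2) ^ k" if "l \<ge> 0" for l
    proof -
      have "exp (- (l * t)) * cosh (l / 2) = (1 + exp (- l)) / 2"
        by (simp add: t cosh_field_def distrib_left flip: exp_add)
      with bound[OF that] show ?thesis by simp
    qed
    have "((\<lambda>l::real. exp (- l)) \<longlongrightarrow> 0) at_top"
      by (rule filterlim_compose[OF exp_at_bot filterlim_uminus_at_bot_at_top])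
    then have "((\<lambda>l::real. ((1 + exp (- l)) / 2) ^ k) \<longlongrightarrow> ((1 + 0) / 2) ^ k) at_top"
      by (intro tendsto_intros) auto
    then have "\<P>(\<omega> in M. S A \<omega> \<ge> x) \<le> ((1 + 0) / 2) ^ k"
      by (rule tendsto_lowerbound)
        (use bound' in \<open>auto intro!: eventually_mono[OF eventually_ge_at_top[of 0]]\<close>)
    then show ?thesis
      using bernoulli_KL_half_one by (simp add: t exp_minus inverse_eq_divide)
  qed
  also have "\<dots> = exp (- real k * bernoulli_KL (1/2) (1/2 + t))"
    by (simp flip: exp_of_nat_mult)
  finally show ?thesis by (simp add: t_def k_def)
qed

end

section \<open>A weak form of Pinsker's inequality\<close>

text \<open>
  The difference of the two sides vanishes at \<open>0\<close> and has derivative \<open>- ln (1 - y) - y \<ge> 0\<close>.  At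
  \<open>y = 1\<close> the left-hand side is \<open>0 * ln 0 = 0\<close>.
\<close>

lemma one_minus_mult_ln_ge:
  fixes y :: real
  assumes "0 \<le> y" "y \<le> 1"
  shows "(1 - y) * ln (1 - y) \<ge> - y + y\<^sup>2 / 2"
proof (cases "y = 1")
  case False
  define f where "f y = (1 - y) * ln (1 - y) + y - y\<^sup>2 / 2" for y :: real
  have "f 0 \<le> f y"
  proof (rule DERIV_nonneg_imp_nondecreasing[OF \<open>0 \<le> y\<close>])
    fix u assume u: "0 \<le> u" "u \<le> y"
    then have u1: "u < 1" using assms False by simp
    have "(f has_real_derivative (- ln (1 - u) - u)) (at u)"
      unfolding f_def[abs_def] using u1 by (auto intro!: derivative_eq_intros)
    moreover have "- ln (1 - u) - u \<ge> 0"
      using ln_le_minus_one[of "1 - u"] u1 by simp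
    ultimately show "\<exists>d. (f has_real_derivative d) (at u) \<and> 0 \<le> d" by blast
  qed
  then show ?thesis by (simp add: f_def)
qed simp

lemma one_plus_mult_ln_ge:
  fixes y :: real
  assumes "0 \<le> y"
  shows "(1 + y) * ln (1 + y) \<ge> y"
proof -
  have "- ln (1 + y) \<le> inverse (1 + y) - 1"
    using ln_le_minus_one[of "inverse (1 + y)"] assms by (simp add: ln_inverse)
  then have "(1 + y) * (1 - inverse (1 + y)) \<le> (1 + y) * ln (1 + y)"
    using assms by (intro mult_left_mono) auto
  moreover have "(1 + y) * (1 - inverse (1 + y)) = y"
    using assms by (simp add: right_diff_distrib)
  ultimately show ?thesis by simp
qed

text \<open>
  With \<open>y = 2 * t\<close> the divergence is half of \<open>(1 + y) * ln (1 + y) + (1 - y) * ln (1 - y)\<close>.  The linear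
  terms of the bounds for the two summands cancel, and the quadratic term of the second one
  remains.
\<close>

lemma bernoulli_KL_half_ge_square:
  assumes "0 \<le> t" "t \<le> 1/2"
  shows "bernoulli_KL (1/2) (1/2 + t) \<ge> t\<^sup>2"
proof -
  have "bernoulli_KL (1/2) (1/2 + t) = ((1 + 2*t) * ln (1 + 2*t) + (1 - 2*t) * ln (1 - 2*t)) / 2"
  proof -
    have "(1/2 + t) / (1/2) = 1 + 2*t" "(1 - (1/2 + t)) / (1 - 1/2) = 1 - 2*t" by simp_all
    then show ?thesis by (simp only: bernoulli_KL_def) (simp add: algebra_simps add_divide_distrib)
  qed
  with one_plus_mult_ln_ge[of "2*t"] one_minus_mult_ln_ge[of "2*t"] assms show ?thesis
    by (simp add: power_mult_distrib)
qed

section \<open>The Irwin--Hall distribution\<close>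

lemma uniform_sample_coordinates:
  fixes k :: nat
  assumes "k \<ge> 1"
  shows "uniform_sample (\<Pi>\<^sub>M i\<in>{..<k}. uniform_measure lborel {0..1}) (\<lambda>i u. u i) {..<k}"
proof -
  let ?P = "\<Pi>\<^sub>M i\<in>{..<k}. uniform_measure lborel {0..1::real}"
  interpret prob_space ?P
    by (intro prob_space_PiM prob_space_unif)
  have ne: "{..<k} \<noteq> {}" using assms by (auto simp: lessThan_empty_iff)
  have rv: "(\<lambda>u. u i) \<in> borel_measurable ?P" if "i < k" for i
    using measurable_component_singleton[of i "{..<k}" "\<lambda>_. uniform_measure lborel {0..1::real}"] that
    by simp
  have comp: "distr ?P borel (\<lambda>u. u i) = uniform_measure lborel {0..1}" if "i < k" for i
  proof -
    have "distr ?P borel (\<lambda>u. u i) = distr ?P (uniform_measure lborel {0..1}) (\<lambda>u. u i)"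
      by (rule distr_cong) simp_all
    also have "\<dots> = uniform_measure lborel {0..1}"
      using that by (intro distr_PiM_component prob_space_unif) auto
    finally show ?thesis .
  qed
  have "distr ?P (\<Pi>\<^sub>M i\<in>{..<k}. borel) (\<lambda>u. \<lambda>i\<in>{..<k}. u i) = distr ?P ?P (\<lambda>u. u)"
    by (intro distr_cong sets_PiM_cong) (auto simp: space_PiM PiE_restrict)
  also have "\<dots> = ?P"
    by (rule distr_id)
  also have "\<dots> = (\<Pi>\<^sub>M i\<in>{..<k}. distr ?P borel (\<lambda>u. u i))"
    by (intro PiM_cong) (auto simp: comp)
  finally have "indep_vars (\<lambda>_. borel) (\<lambda>i u. u i) {..<k}"
    by (subst indep_vars_iff_distr_eq_PiM'[OF ne]) (auto simp: rv)
  then show ?thesis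
    by unfold_locales (auto simp: comp)
qed

text \<open>
  Tail probabilities depend only on the law, so those of any Irwin--Hall variable can be computed on the
  product space of its coordinates.
\<close>

lemma irwin_hall_tails:
  fixes x :: real
  assumes "k \<ge> 1" and Y: "follows_irwin_hall M Y k" and X: "X = (\<lambda>\<omega>. Y \<omega> - real k / 2)"
  defines "P \<equiv> \<Pi>\<^sub>M i\<in>{..<k}. uniform_measure lborel {0..1}"
  defines "T \<equiv> uniform_sample.S (\<lambda>i u. u i) {..<k}"
  shows "\<P>(\<omega> in M. X \<omega> \<le> - x) = \<P>(u in P. T u \<le> - x)"
    and "\<P>(\<omega> in M. X \<omega> \<ge> x) = \<P>(u in P. T u \<ge> x)"
proof -
  interpret uniform_sample P "\<lambda>i u. u i" "{..<k}"
    unfolding P_def using assms(1) by (rule uniform_sample_coordinates)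
  have [measurable]: "Y \<in> borel_measurable M" and law: "distr M borel Y = irwin_hall k"
    using Y by (auto simp: follows_irwin_hall_def)
  have sum_rv: "(\<lambda>u. \<Sum>i<k. u i) \<in> borel_measurable P"
    using rv by auto
  have S: "T u = (\<Sum>i<k. u i) - real k / 2" for u
    by (simp add: T_def S_def sum_subtractf)
  have "\<P>(\<omega> in M. X \<omega> \<le> - x) = measure (distr M borel Y) {.. real k / 2 - x}"
    by (subst measure_distr) (auto simp: X intro!: arg_cong[where f="measure M"])
  also have "\<dots> = \<P>(u in P. T u \<le> - x)"
    unfolding law irwin_hall_def P_def[symmetric] using sum_rv
    by (subst measure_distr) (auto simp: S intro!: arg_cong[where f="measure P"])
  finally show "\<P>(\<omega> in M. X \<omega> \<le> - x) = \<P>(u in P. T u \<le> - x)" .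
  have "\<P>(\<omega> in M. X \<omega> \<ge> x) = measure (distr M borel Y) {real k / 2 + x..}"
    by (subst measure_distr) (auto simp: X intro!: arg_cong[where f="measure M"])
  also have "\<dots> = \<P>(u in P. T u \<ge> x)"
    unfolding law irwin_hall_def P_def[symmetric] using sum_rv
    by (subst measure_distr) (auto simp: S intro!: arg_cong[where f="measure P"])
  finally show "\<P>(\<omega> in M. X \<omega> \<ge> x) = \<P>(u in P. T u \<ge> x)" .
qed

theorem corollary5:
  "(\<forall>(k::nat) (M::'a measure) (Y::'a \<Rightarrow> real) (X::'a \<Rightarrow> real) (x::real).
      k \<ge> 1 \<and> follows_irwin_hall M Y k \<and> X = (\<lambda>\<omega>. Y \<omega> - real k / 2) \<and>
      0 \<le> x \<and> x \<le> real k / 2 \<longrightarrow>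
        \<P>(\<omega> in M. X \<omega> \<le> - x) = \<P>(\<omega> in M. X \<omega> \<ge> x) \<and>
        \<P>(\<omega> in M. X \<omega> \<ge> x) \<le> exp (- real k * bernoulli_KL (1/2) (1/2 + x / real k)) \<and>
        exp (- real k * bernoulli_KL (1/2) (1/2 + x / real k)) \<le> exp (- (x\<^sup>2 / real k))) \<and>
   (\<exists>c c' C :: real. c > 0 \<and> c' > 0 \<and> C > 0 \<and>
     (\<forall>(k::nat) (M::'a measure) (Y::'a \<Rightarrow> real) (X::'a \<Rightarrow> real) (x::real).
        k \<ge> 1 \<and> follows_irwin_hall M Y k \<and> X = (\<lambda>\<omega>. Y \<omega> - real k / 2) \<and>
        0 \<le> x \<and> x \<le> c' * real k \<longrightarrow>
          \<P>(\<omega> in M. X \<omega> \<le> - x) = \<P>(\<omega> in M. X \<omega> \<ge> x) \<and>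
          \<P>(\<omega> in M. X \<omega> \<ge> x) \<ge> c * exp (- C * (x\<^sup>2 / real k))))"
proof -
  have symm: "\<P>(\<omega> in M. X \<omega> \<le> - x) = \<P>(\<omega> in M. X \<omega> \<ge> x)"
    and upper: "x \<le> real k / 2 \<Longrightarrow>
      \<P>(\<omega> in M. X \<omega> \<ge> x) \<le> exp (- real k * bernoulli_KL (1/2) (1/2 + x / real k))"
    and lower: "x \<le> 1 / 8 * real k \<Longrightarrow>
      \<P>(\<omega> in M. X \<omega> \<ge> x) \<ge> 1 / 48 * exp (- (48 * ln 24) * (x\<^sup>2 / real k))"
    if *: "k \<ge> 1" "follows_irwin_hall M Y k" "X = (\<lambda>\<omega>. Y \<omega> - real k / 2)" "0 \<le> x"
    for k x and M :: "'a measure" and X Y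
  proof -
    interpret uniform_sample "\<Pi>\<^sub>M i\<in>{..<k}. uniform_measure lborel {0..1}" "\<lambda>i u. u i" "{..<k}"
      using *(1) by (rule uniform_sample_coordinates)
    have ne: "{..<k} \<noteq> {}" using *(1) by (auto simp: lessThan_empty_iff)
    note tails = irwin_hall_tails[OF *(1-3), of x]
    show "\<P>(\<omega> in M. X \<omega> \<le> - x) = \<P>(\<omega> in M. X \<omega> \<ge> x)"
      unfolding tails by (rule prob_S_symmetric) simp
    show "\<P>(\<omega> in M. X \<omega> \<ge> x) \<le> exp (- real k * bernoulli_KL (1/2) (1/2 + x / real k))"
      if "x \<le> real k / 2"
      unfolding tails using prob_S_upper[of "{..<k}" x] ne *(4) that by simp
    show "\<P>(\<omega> in M. X \<omega> \<ge> x) \<ge> 1 / 48 * exp (- (48 * ln 24) * (x\<^sup>2 / real k))"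
      if "x \<le> 1 / 8 * real k"
      unfolding tails using prob_S_lower[of "{..<k}" x] ne *(4) that by simp
  qed
  have pinsker: "exp (- real k * bernoulli_KL (1/2) (1/2 + x / real k)) \<le> exp (- (x\<^sup>2 / real k))"
    if "k \<ge> 1" "0 \<le> x" "x \<le> real k / 2" for k :: nat and x :: real
  proof -
    have "(x / real k)\<^sup>2 \<le> bernoulli_KL (1/2) (1/2 + x / real k)"
      using that by (intro bernoulli_KL_half_ge_square) (auto simp: field_simps)
    then have "real k * (x / real k)\<^sup>2 \<le> real k * bernoulli_KL (1/2) (1/2 + x / real k)"
      by (rule mult_left_mono) simp
    moreover have "real k * (x / real k)\<^sup>2 = x\<^sup>2 / real k"
      using that by (simp add: power2_eq_square)
    ultimately show ?thesis by simp
  qed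
  have ex: "\<exists>c c' C :: real. c > 0 \<and> c' > 0 \<and> C > 0 \<and>
     (\<forall>(k::nat) (M::'a measure) (Y::'a \<Rightarrow> real) (X::'a \<Rightarrow> real) (x::real).
        k \<ge> 1 \<and> follows_irwin_hall M Y k \<and> X = (\<lambda>\<omega>. Y \<omega> - real k / 2) \<and>
        0 \<le> x \<and> x \<le> c' * real k \<longrightarrow>
          \<P>(\<omega> in M. X \<omega> \<le> - x) = \<P>(\<omega> in M. X \<omega> \<ge> x) \<and>
          \<P>(\<omega> in M. X \<omega> \<ge> x) \<ge> c * exp (- C * (x\<^sup>2 / real k)))"
    by (rule exI[of _ "1/48"], rule exI[of _ "1/8"], rule exI[of _ "48 * ln 24"])
      (use symm lower in auto)
  show ?thesis
    by (intro conjI ex allI impI; elim conjE; (rule symm upper pinsker; assumption))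
qed

end
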